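(* Let $\mathcal G$ be a (possibly infinite) connected planar map with conductances whose vertices and faces all have finite degree, with a distinguished external face, boundary vertex set $\partial\mathcal G$, and marked vertices $\mathbf x\in V\setminus\partial\mathcal G$ and $\mathbf y\in\partial\mathcal G$. Let $\{\mathcal G_n\}_{n\ge1}$ be an increasing family of finite connected submaps of $\mathcal G$ whose union is all of $\mathcal G$. Assume that $\partial\mathcal G\cup\{\mathbf x\}\subset V(\mathcal G_n)$ for every $n\ge1$ and set $\partial\mathcal G_n:=\partial\mathcal G$. Then the Tutte embeddings of $(\mathcal G_n,\mathbf x,\mathbf y)$ converge pointwise on $V$ to the Tutte embedding of $(\mathcal G,\mathbf x,\mathbf y)$ as $n\to\infty$.
   Context: Setting. $\mathcal G$ has vertex set $V$, edge set $E$ and a conductance function $\mathfrak c:E\to(0,\infty)$. It is drawn in the plane so that the external face is the unique unbounded face; the vertex set may have accumulation points in the plane. $\partial\mathcal G\subset V$ is the (finite) set of vertices on the boundary of the external face. A submap of $\mathcal G$ is a subgraph with the inherited planar map structure and the restricted conductances. Energy-minimizing functions and harmonic measure. $\operatorname{Energy}(f)=\sum_{e=\{x,y\}\in E}\mathfrak c(e)|f(y)-f(x)|^2$. For each non-empty finite $\mathcal A\subset V$ and $\phi:\mathcal A\to\mathbb R$ there is a unique function $h^\phi:V\to\mathbb R$ with $h^\phi|_{\mathcal A}=\phi$ of minimal energy among all functions agreeing with $\phi$ on $\mathcal A$. For $y\in\mathcal A$ and $x\in V$, $\operatorname{hm}^x_{\mathcal A}(y):=h^{\mathbf 1_y}(x)$,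 where $\mathbf 1_y:\mathcal A\to\mathbb R$ equals $1$ at $y$ and $0$ elsewhere. The same definitions apply to finite connected graphs (where $h^\phi$ is the unique extension of $\phi$ that is discrete harmonic off $\mathcal A$). Tutte embedding. Trace the boundary of the external face of $\mathcal G$ in counterclockwise order starting and ending at $\mathbf y$, and let $y_1,\dots,y_m$ be the distinct vertices of $\partial\mathcal G$ enumerated by the last time they are visited, so $y_m=\mathbf y$. Define $H(y_k)=\exp\bigl(2\pi i\sum_{j=1}^k\operatorname{hm}^{\mathbf x}_{\partial\mathcal G}(y_j)\bigr)$ for $k=1,\dots,m$, and extend $H$ to $V$ by requiring that its real and imaginary parts are the energy-minimizing functions on $V$ with the given values on $\partial\mathcal G$. $H:V\to\overline{\mathbb D}$ is the Tutte embedding of $(\mathcal G,\mathbf x,\mathbf y)$. The Tutte embedding $H_n:V(\mathcal G_n)\to\overline{\mathbb D}$ of $(\mathcal G_n,\mathbf x,\mathbf y)$ is defined in the same way with the energy and harmonic measure of $\mathcal G_n$, the boundary set $\partial\mathcal G_n=\partial\mathcal G$, and the same enumeration $y_1,\dots,y_m$. Pointwise convergence means $H_n(x)\to H(x)$ for each $x\in V$ (with $H_n(x)$ defined for $n$ large). *)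

theory Defs
  imports "HOL-Analysis.Analysis"
begin

text \<open>
  A planar map is a multigraph drawn in the complex plane: vertices are points, and the edge
  \<open>e\<close> is the curve \<open>curve G e\<close>, parametrised by \<open>[0,1]\<close>. The sense in which an edge is
  parametrised carries no meaning. Loops and multiple edges are allowed.
\<close>

record 'e cmap =
  verts :: "complex set"
  edges :: "'e set"
  curve :: "'e \<Rightarrow> real \<Rightarrow> complex"
  cond :: "'e \<Rightarrow> real"

definition ends :: "'e cmap \<Rightarrow> 'e \<Rightarrow> complex set" where
  "ends G e = {pathstart (curve G e), pathfinish (curve G e)}"

text \<open>
  No local finiteness of the drawing is imposed: vertices may accumulate in the plane.
\<close>

definition planar_map :: "'e cmap \<Rightarrow> bool" where
  "planar_map G \<longleftrightarrow>
     (\<forall>e\<in>edges G. simple_path (curve G e) \<and> ends G e \<subseteq> verts G \<and> 0 < cond G e) \<and>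
     (\<forall>e\<in>edges G. curve G e ` {0<..<1} \<inter> verts G = {}) \<and>
     (\<forall>e\<in>edges G. \<forall>e'\<in>edges G. e \<noteq> e' \<longrightarrow>
        curve G e ` {0<..<1} \<inter> curve G e' ` {0<..<1} = {})"

definition connected_map :: "'e cmap \<Rightarrow> bool" where
  "connected_map G \<longleftrightarrow> verts G \<noteq> {} \<and>
     (\<forall>u\<in>verts G. \<forall>v\<in>verts G. (u, v) \<in> {(a, b). \<exists>e\<in>edges G. ends G e = {a, b}}\<^sup>*)"

definition finite_map :: "'e cmap \<Rightarrow> bool" where
  "finite_map G \<longleftrightarrow> finite (verts G) \<and> finite (edges G)"

definition submap :: "'e cmap \<Rightarrow> 'e cmap \<Rightarrow> bool" where
  "submap G' G \<longleftrightarrow>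
     verts G' \<subseteq> verts G \<and> edges G' \<subseteq> edges G \<and>
     (\<forall>e\<in>edges G'. curve G' e = curve G e \<and> cond G' e = cond G e \<and> ends G' e \<subseteq> verts G')"

definition drawing :: "'e cmap \<Rightarrow> complex set" where
  "drawing G = verts G \<union> (\<Union>e\<in>edges G. path_image (curve G e))"

text \<open>
  The closure removes the accumulation points of an infinite drawing from the faces. It may
  leave components whose frontier consists of accumulation points only; they have no
  boundary edges, so the finiteness condition below holds trivially for them.
\<close>

definition faces :: "'e cmap \<Rightarrow> complex set set" where
  "faces G = components (- closure (drawing G))"

definition finite_vertex_degrees :: "'e cmap \<Rightarrow> bool" where
  "finite_vertex_degrees G \<longleftrightarrow> (\<forall>v\<in>verts G. finite {e \<in> edges G. v \<in> ends G e})"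

definition finite_face_degrees :: "'e cmap \<Rightarrow> bool" where
  "finite_face_degrees G \<longleftrightarrow>
     (\<forall>F\<in>faces G. finite {e \<in> edges G. path_image (curve G e) \<subseteq> frontier F})"

definition has_external_face :: "'e cmap \<Rightarrow> bool" where
  "has_external_face G \<longleftrightarrow> (\<exists>!F. F \<in> faces G \<and> \<not> bounded F)"

definition external_face :: "'e cmap \<Rightarrow> complex set" where
  "external_face G = (THE F. F \<in> faces G \<and> \<not> bounded F)"

definition boundary_verts :: "'e cmap \<Rightarrow> complex set" where
  "boundary_verts G = verts G \<inter> frontier (external_face G)"

text \<open>
  Tracing the boundary of the external face once, counterclockwise, with the correct
  multiplicities at cut vertices and bridges: \<open>\<gamma>\<close> is the image of the counterclockwise unit
  circle under the boundary extension of a conformal map fixing \<open>\<infinity>\<close> from the exterior of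
  the closed unit disc onto the external face. When the frontier of that face is a finite
  union of edges, such an extension exists by Caratheodory's theorem. If the starting vertex
  \<open>y\<close> is visited several times, the trace may start at any one of these visits.
\<close>

definition boundary_trace :: "'e cmap \<Rightarrow> complex \<Rightarrow> (real \<Rightarrow> complex) \<Rightarrow> bool" where
  "boundary_trace G y \<gamma> \<longleftrightarrow>
     (\<exists>\<Phi>. \<Phi> holomorphic_on {z. 1 < norm z} \<and> inj_on \<Phi> {z. 1 < norm z} \<and>
          \<Phi> ` {z. 1 < norm z} = external_face G \<and>
          filterlim \<Phi> at_infinity at_infinity \<and>
          continuous_on {z. 1 \<le> norm z} \<Phi> \<and>
          (\<forall>t\<in>{0..1}. \<gamma> t = \<Phi> (cis (2 * pi * t)))) \<and>
     pathstart \<gamma> = y \<and> pathfinish \<gamma> = y"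

definition last_visit :: "(real \<Rightarrow> complex) \<Rightarrow> complex \<Rightarrow> real" where
  "last_visit \<gamma> v = Sup {t \<in> {0..1}. \<gamma> t = v}"

definition boundary_enumeration ::
    "'e cmap \<Rightarrow> complex \<Rightarrow> nat \<Rightarrow> (nat \<Rightarrow> complex) \<Rightarrow> bool" where
  "boundary_enumeration G y m ys \<longleftrightarrow>
     bij_betw ys {1..m} (boundary_verts G) \<and>
     (\<exists>\<gamma>. boundary_trace G y \<gamma> \<and> strict_mono_on {1..m} (\<lambda>k. last_visit \<gamma> (ys k)))"

definition energy :: "'e cmap \<Rightarrow> (complex \<Rightarrow> real) \<Rightarrow> ennreal" where
  "energy G f = (\<Sum>\<^sub>\<infinity>e\<in>edges G.
     ennreal (cond G e * \<bar>f (pathfinish (curve G e)) - f (pathstart (curve G e))\<bar>\<^sup>2))"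

text \<open>
  Functions on the vertex set are represented by functions on the plane that are
  \<^const>\<open>undefined\<close> off it, which makes the minimiser unique.
\<close>

definition energy_minimizer ::
    "'e cmap \<Rightarrow> complex set \<Rightarrow> (complex \<Rightarrow> real) \<Rightarrow> complex \<Rightarrow> real" where
  "energy_minimizer G A \<phi> =
     (THE h. h \<in> extensional (verts G) \<and> (\<forall>a\<in>A. h a = \<phi> a) \<and>
             (\<forall>g. (\<forall>a\<in>A. g a = \<phi> a) \<longrightarrow> energy G h \<le> energy G g))"

definition hm :: "'e cmap \<Rightarrow> complex set \<Rightarrow> complex \<Rightarrow> complex \<Rightarrow> real" where
  "hm G A x y = energy_minimizer G A (indicator {y}) x"

text \<open>
  The boundary set is given by its enumeration \<open>ys 1, \<dots>, ys m\<close>, so that the same definition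
  serves for a map and for its submaps.
\<close>

definition tutte_boundary ::
    "'e cmap \<Rightarrow> complex \<Rightarrow> nat \<Rightarrow> (nat \<Rightarrow> complex) \<Rightarrow> complex \<Rightarrow> complex" where
  "tutte_boundary G x m ys v =
     (let k = the_inv_into {1..m} ys v
      in exp (2 * pi * \<i> * of_real (\<Sum>j=1..k. hm G (ys ` {1..m}) x (ys j))))"

definition tutte_embedding ::
    "'e cmap \<Rightarrow> complex \<Rightarrow> nat \<Rightarrow> (nat \<Rightarrow> complex) \<Rightarrow> complex \<Rightarrow> complex" where
  "tutte_embedding G x m ys v =
     Complex (energy_minimizer G (ys ` {1..m}) (\<lambda>a. Re (tutte_boundary G x m ys a)) v)
             (energy_minimizer G (ys ` {1..m}) (\<lambda>a. Im (tutte_boundary G x m ys a)) v)"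

end

(* A minimizer h_n on G_n competes, restricted to G_j, with the minimizer h_j for j \<le> n, so the
   minimal energies increase; they are bounded because an extension of the boundary data by 0 has
   finite energy. By the parallelogram law the energy of h_j - h_n on G_j tends to 0, hence the
   values of h_n converge along every path starting in A. By Fatou the limit has at most the
   limiting energy, and the parallelogram law identifies it with the minimizer on G. The same
   argument on the constant exhaustion yields existence and uniqueness on finite networks. Since the
   boundary values of the Tutte embedding also depend on n, linearity in the boundary data reduces
   the varying case to that of finitely many harmonic measures. *)
theory Submission
  imports Defs
begin

section \<open>Dirichlet sums over finite sets of edges\<close>

definition network :: "'e cmap \<Rightarrow> bool" where
  "network G \<longleftrightarrow> (\<forall>e\<in>edges G. ends G e \<subseteq> verts G \<and> 0 < cond G e)"

definition edge_diff :: "'e cmap \<Rightarrow> (complex \<Rightarrow> real) \<Rightarrow> 'e \<Rightarrow> real" where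
  "edge_diff G f e = f (pathfinish (curve G e)) - f (pathstart (curve G e))"

text \<open>Real-valued and restricted to \<open>F\<close>, so that energies can be subtracted and
  the energy of a submap is a partial sum taken in the same map \<open>G\<close>.\<close>

definition dirichlet_sum :: "'e cmap \<Rightarrow> 'e set \<Rightarrow> (complex \<Rightarrow> real) \<Rightarrow> real" where
  "dirichlet_sum G F f = (\<Sum>e\<in>F. cond G e * (edge_diff G f e)\<^sup>2)"

definition dirichlet_form ::
    "'e cmap \<Rightarrow> 'e set \<Rightarrow> (complex \<Rightarrow> real) \<Rightarrow> (complex \<Rightarrow> real) \<Rightarrow> real" where
  "dirichlet_form G F f g = (\<Sum>e\<in>F. cond G e * edge_diff G f e * edge_diff G g e)"

lemma network_cond_pos: "network G \<Longrightarrow> e \<in> edges G \<Longrightarrow> 0 < cond G e"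
  by (simp add: network_def)

lemma network_endpoints:
  assumes "network G" "e \<in> edges G"
  shows "pathstart (curve G e) \<in> verts G" "pathfinish (curve G e) \<in> verts G"
  using assms by (auto simp: network_def ends_def)

lemma edge_term_nonneg:
  assumes "network G" "e \<in> edges G"
  shows "0 \<le> cond G e * (edge_diff G f e)\<^sup>2"
  using network_cond_pos[OF assms] by simp

lemma dirichlet_sum_nonneg:
  assumes "network G" "F \<subseteq> edges G"
  shows "0 \<le> dirichlet_sum G F f"
  unfolding dirichlet_sum_def
  by (rule sum_nonneg) (use assms in \<open>auto intro: edge_term_nonneg\<close>)

lemma dirichlet_sum_mono:
  assumes "network G" "F' \<subseteq> edges G" "finite F'" "F \<subseteq> F'"
  shows "dirichlet_sum G F f \<le> dirichlet_sum G F' f"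
  unfolding dirichlet_sum_def
  by (rule sum_mono2) (use assms in \<open>auto intro: edge_term_nonneg\<close>)

lemma edge_term_le_dirichlet_sum:
  assumes "network G" "F \<subseteq> edges G" "finite F" "e \<in> F"
  shows "cond G e * (edge_diff G f e)\<^sup>2 \<le> dirichlet_sum G F f"
  using dirichlet_sum_mono[OF assms(1-3), of "{e}"] assms(4) by (simp add: dirichlet_sum_def)

text \<open>The mean of two functions with common boundary data has that data too, so a lower bound
  on its energy turns this identity into control of the difference.\<close>

lemma dirichlet_sum_parallelogram:
  "dirichlet_sum G F (\<lambda>v. f v - g v) =
     2 * dirichlet_sum G F f + 2 * dirichlet_sum G F g
     - 4 * dirichlet_sum G F (\<lambda>v. (f v + g v) / 2)"
  unfolding dirichlet_sum_def edge_diff_def sum_distrib_left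
  by (simp flip: sum.distrib sum_subtractf)
     (rule sum.cong; simp add: power2_eq_square field_simps)

text \<open>Serves both the first variation, with a well chosen \<open>r\<close>, and the
  Pythagorean identity, with \<open>r = 1\<close> and vanishing cross term.\<close>

lemma dirichlet_sum_add_scaled:
  "dirichlet_sum G F (\<lambda>v. f v + r * g v) =
     dirichlet_sum G F f + 2 * r * dirichlet_form G F f g + r\<^sup>2 * dirichlet_sum G F g"
  unfolding dirichlet_sum_def dirichlet_form_def edge_diff_def sum_distrib_left
  by (simp flip: sum.distrib) (rule sum.cong; simp add: power2_eq_square algebra_simps)

lemma dirichlet_form_sum_left:
  "dirichlet_form G F (\<lambda>v. \<Sum>a\<in>A. \<phi> a * f a v) g = (\<Sum>a\<in>A. \<phi> a * dirichlet_form G F (f a) g)"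
proof -
  have "edge_diff G (\<lambda>v. \<Sum>a\<in>A. \<phi> a * f a v) e = (\<Sum>a\<in>A. \<phi> a * edge_diff G (f a) e)" for e
    by (simp add: edge_diff_def sum_subtractf right_diff_distrib)
  then have "dirichlet_form G F (\<lambda>v. \<Sum>a\<in>A. \<phi> a * f a v) g =
      (\<Sum>e\<in>F. \<Sum>a\<in>A. \<phi> a * (cond G e * edge_diff G (f a) e * edge_diff G g e))"
    by (simp add: dirichlet_form_def sum_distrib_left sum_distrib_right mult_ac)
  also have "\<dots> = (\<Sum>a\<in>A. \<phi> a * dirichlet_form G F (f a) g)"
    by (subst sum.swap) (simp add: dirichlet_form_def sum_distrib_left)
  finally show ?thesis .
qed

section \<open>The energy as the supremum of its finite partial sums\<close>

lemma energy_eq_infsum: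
  "energy G f = (\<Sum>\<^sub>\<infinity>e\<in>edges G. ennreal (cond G e * (edge_diff G f e)\<^sup>2))"
  by (simp add: energy_def edge_diff_def)

lemma dirichlet_sum_le_energy:
  assumes "network G" "F \<subseteq> edges G" "finite F"
  shows "ennreal (dirichlet_sum G F f) \<le> energy G f"
proof -
  have "ennreal (dirichlet_sum G F f) = (\<Sum>e\<in>F. ennreal (cond G e * (edge_diff G f e)\<^sup>2))"
    unfolding dirichlet_sum_def
    by (rule sum_ennreal[symmetric]) (use assms in \<open>auto intro: edge_term_nonneg\<close>)
  also have "\<dots> = (\<Sum>\<^sub>\<infinity>e\<in>F. ennreal (cond G e * (edge_diff G f e)\<^sup>2))"
    using assms by simp
  also have "\<dots> \<le> energy G f"
    unfolding energy_eq_infsum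
    by (rule infsum_mono_neutral) (use assms in \<open>auto intro: nonneg_summable_on_complete\<close>)
  finally show ?thesis .
qed

lemma energy_le:
  assumes "network G" "\<And>F. F \<subseteq> edges G \<Longrightarrow> finite F \<Longrightarrow> dirichlet_sum G F f \<le> r"
  shows "energy G f \<le> ennreal r"
proof -
  have "(\<Sum>e\<in>F. ennreal (cond G e * (edge_diff G f e)\<^sup>2)) \<le> ennreal r"
    if "F \<subseteq> edges G" "finite F" for F
  proof -
    have "(\<Sum>e\<in>F. ennreal (cond G e * (edge_diff G f e)\<^sup>2)) = ennreal (dirichlet_sum G F f)"
      unfolding dirichlet_sum_def
      by (rule sum_ennreal) (use assms(1) that in \<open>auto intro: edge_term_nonneg\<close>)
    with assms(2)[OF that] show ?thesis by (simp add: ennreal_leI)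
  qed
  then show ?thesis
    unfolding energy_eq_infsum
    by (intro infsum_le_finite_sums) (auto intro: nonneg_summable_on_complete)
qed

text \<open>The step is an equivalence because a path may cross an edge against its
  parametrisation.\<close>

lemma connected_map_induct:
  assumes "connected_map G" "u \<in> verts G" "v \<in> verts G" "P u"
    and step: "\<And>e. e \<in> edges G \<Longrightarrow> P (pathstart (curve G e)) \<longleftrightarrow> P (pathfinish (curve G e))"
  shows "P v"
proof -
  have "(u, v) \<in> {(a, b). \<exists>e\<in>edges G. ends G e = {a, b}}\<^sup>*"
    using assms by (simp add: connected_map_def)
  then show ?thesis
  proof (induction rule: rtrancl_induct)
    case base
    show ?case by fact
  next
    case (step b c)
    then obtain e where "e \<in> edges G" "ends G e = {b, c}" by auto
    with step.IH assms(5)[of e] show ?case by (auto simp: ends_def doubleton_eq_iff)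
  qed
qed

section \<open>Convergence of almost minimizing sequences\<close>

text \<open>
  Covers both an exhaustion by finite networks and, with constant \<open>E\<close>, a minimising sequence on
  one finite network.
\<close>

locale almost_minimizing =
  fixes G :: "'e cmap" and A :: "complex set" and \<phi> :: "complex \<Rightarrow> real"
    and E :: "nat \<Rightarrow> 'e set" and f :: "nat \<Rightarrow> complex \<Rightarrow> real"
    and upper lower :: "nat \<Rightarrow> real" and J :: real
  assumes network: "network G" and connected: "connected_map G"
    and A: "A \<subseteq> verts G" "A \<noteq> {}"
    and E_finite: "finite (E k)" and E_mono: "mono E" and E_UN: "(\<Union>k. E k) = edges G"
    and f_A: "a \<in> A \<Longrightarrow> f k a = \<phi> a"
    and upper: "dirichlet_sum G (E k) (f k) \<le> upper k"
    and lower: "(\<And>a. a \<in> A \<Longrightarrow> g a = \<phi> a) \<Longrightarrow> lower k \<le> dirichlet_sum G (E k) g"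
    and upper_lim: "upper \<longlonglongrightarrow> J" and lower_lim: "lower \<longlonglongrightarrow> J"
begin

lemma E_sub: "E k \<subseteq> edges G"
  using E_UN by blast

text \<open>The mean of \<open>f k\<close> and \<open>g\<close> still equals \<open>\<phi>\<close>
  on \<open>A\<close>, so \<open>lower k\<close> bounds its sum from below in the parallelogram
  law.\<close>

lemma dirichlet_sum_diff_le:
  assumes "\<And>a. a \<in> A \<Longrightarrow> g a = \<phi> a"
  shows "dirichlet_sum G (E k) (\<lambda>v. f k v - g v)
           \<le> 2 * upper k + 2 * dirichlet_sum G (E k) g - 4 * lower k"
proof -
  have "lower k \<le> dirichlet_sum G (E k) (\<lambda>v. (f k v + g v) / 2)"
    by (rule lower) (simp add: f_A assms)
  with upper[of k] show ?thesis
    unfolding dirichlet_sum_parallelogram by linarith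
qed

text \<open>The difference bound for \<open>h\<close> tends to
  \<open>2 * J + 2 * J - 4 * J = 0\<close>, so \<open>f k - h\<close> becomes constant across each
  edge in the limit. It vanishes on \<open>A\<close>, and connectedness carries the convergence to
  every vertex. As \<open>f\<close> does not depend on \<open>h\<close>, this also forces uniqueness
  of \<open>h\<close> on the vertices.\<close>

lemma tendsto_minimizer:
  assumes h_A: "\<And>a. a \<in> A \<Longrightarrow> h a = \<phi> a" and h_le: "\<And>k. dirichlet_sum G (E k) h \<le> J"
    and "v \<in> verts G"
  shows "(\<lambda>k. f k v) \<longlonglongrightarrow> h v"
proof -
  obtain u where u: "u \<in> A" using A by blast
  show ?thesis
  proof (rule connected_map_induct[of G u v "\<lambda>v. (\<lambda>k. f k v) \<longlonglongrightarrow> h v"])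
    show "(\<lambda>k. f k u) \<longlonglongrightarrow> h u" using u by (simp add: f_A h_A)
  next
    fix e assume e: "e \<in> edges G"
    then obtain k0 where k0: "e \<in> E k0" using E_UN by blast
    define s t where "s = pathstart (curve G e)" and "t = pathfinish (curve G e)"
    let ?d = "\<lambda>k. edge_diff G (\<lambda>v. f k v - h v) e"
    let ?c = "cond G e"
    have c: "0 < ?c" using network e by (rule network_cond_pos)
    have bound: "(?d k)\<^sup>2 \<le> (2 * upper k + 2 * J - 4 * lower k) / ?c" if "k \<ge> k0" for k
    proof -
      have "?c * (?d k)\<^sup>2 \<le> dirichlet_sum G (E k) (\<lambda>v. f k v - h v)"
        using k0 that E_mono[THEN monoD] by (intro edge_term_le_dirichlet_sum network E_sub E_finite) blast
      also have "\<dots> \<le> 2 * upper k + 2 * J - 4 * lower k"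
        using dirichlet_sum_diff_le[OF h_A, of k] h_le[of k] by linarith
      finally show ?thesis using c by (simp add: field_simps)
    qed
    have "(\<lambda>k. (2 * upper k + 2 * J - 4 * lower k) / ?c) \<longlonglongrightarrow> (2 * J + 2 * J - 4 * J) / ?c"
      using c by (intro tendsto_intros upper_lim lower_lim) auto
    then have lim0: "(\<lambda>k. (2 * upper k + 2 * J - 4 * lower k) / ?c) \<longlonglongrightarrow> 0" by simp
    have "(\<lambda>k. (?d k)\<^sup>2) \<longlonglongrightarrow> 0"
      by (rule tendsto_sandwich[OF _ _ tendsto_const lim0])
         (auto simp: eventually_sequentially intro: bound)
    then have d: "?d \<longlonglongrightarrow> 0" by simp
    have "(\<lambda>k. f k t) \<longlonglongrightarrow> h t" if "(\<lambda>k. f k s) \<longlonglongrightarrow> h s"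
    proof -
      have "(\<lambda>k. ?d k + h t - h s + f k s) \<longlonglongrightarrow> 0 + h t - h s + h s"
        by (intro tendsto_intros d that)
      then show ?thesis by (simp add: edge_diff_def s_def t_def)
    qed
    moreover have "(\<lambda>k. f k s) \<longlonglongrightarrow> h s" if "(\<lambda>k. f k t) \<longlonglongrightarrow> h t"
    proof -
      have "(\<lambda>k. f k t - (?d k + h t - h s)) \<longlonglongrightarrow> h t - (0 + h t - h s)"
        by (intro tendsto_intros d that)
      then show ?thesis by (simp add: edge_diff_def s_def t_def)
    qed
    ultimately show "(\<lambda>k. f k (pathstart (curve G e))) \<longlonglongrightarrow> h (pathstart (curve G e)) \<longleftrightarrow>
        (\<lambda>k. f k (pathfinish (curve G e))) \<longlonglongrightarrow> h (pathfinish (curve G e))"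
      unfolding s_def t_def by blast
  qed (use connected u A assms in auto)
qed

text \<open>For \<open>j \<le> k\<close> the function \<open>f k\<close> is a competitor on the
  smaller set \<open>E j\<close>, so the parallelogram law bounds the energy of
  \<open>f j - f k\<close> there by a quantity that tends to 0.\<close>

lemma edge_diff_convergent:
  assumes e: "e \<in> edges G"
  shows "convergent (\<lambda>k. edge_diff G (f k) e)"
proof -
  obtain k0 where k0: "e \<in> E k0" using e E_UN by blast
  let ?c = "cond G e"
  have c: "0 < ?c" using network e by (rule network_cond_pos)
  have "Cauchy (\<lambda>k. edge_diff G (f k) e)"
  proof (rule metric_CauchyI)
    fix \<epsilon> :: real assume "0 < \<epsilon>"
    \<comment> \<open>With all bounds within \<open>\<eta>\<close> of \<open>J\<close>, the
      coefficients 2, 2 and 4 in the estimate below add up to an error below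
      \<open>8 * \<eta>\<close>.\<close>
    define \<eta> where "\<eta> = ?c * \<epsilon>\<^sup>2 / 8"
    have "0 < \<eta>" using \<open>0 < \<epsilon>\<close> c by (simp add: \<eta>_def)
    then have "eventually (\<lambda>k. dist (upper k) J < \<eta> \<and> dist (lower k) J < \<eta>) sequentially"
      using upper_lim lower_lim by (intro eventually_conj tendstoD)
    then obtain N where N: "\<And>k. k \<ge> N \<Longrightarrow> dist (upper k) J < \<eta> \<and> dist (lower k) J < \<eta>"
      by (auto simp: eventually_sequentially)
    have close: "dist (edge_diff G (f j) e) (edge_diff G (f k) e) < \<epsilon>"
      if "max N k0 \<le> j" "j \<le> k" for j k
    proof -
      have "?c * (edge_diff G (f j) e - edge_diff G (f k) e)\<^sup>2
          = ?c * (edge_diff G (\<lambda>v. f j v - f k v) e)\<^sup>2"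
        by (simp add: edge_diff_def algebra_simps)
      also have "\<dots> \<le> dirichlet_sum G (E j) (\<lambda>v. f j v - f k v)"
        using k0 that E_mono[THEN monoD, of k0 j]
        by (intro edge_term_le_dirichlet_sum network E_sub E_finite) auto
      also have "\<dots> \<le> 2 * upper j + 2 * dirichlet_sum G (E j) (f k) - 4 * lower j"
        by (rule dirichlet_sum_diff_le) (rule f_A)
      also have "dirichlet_sum G (E j) (f k) \<le> upper k"
        using dirichlet_sum_mono[OF network E_sub E_finite, of "E j" k "f k"] upper[of k]
          E_mono[THEN monoD, OF that(2)] by linarith
      finally have "?c * (edge_diff G (f j) e - edge_diff G (f k) e)\<^sup>2
          \<le> 2 * upper j + 2 * upper k - 4 * lower j" by simp
      also have "\<dots> < 8 * \<eta>"
        using N[of j] N[of k] that unfolding dist_real_def by auto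
      also have "\<dots> = ?c * \<epsilon>\<^sup>2" by (simp add: \<eta>_def)
      finally have "\<bar>edge_diff G (f j) e - edge_diff G (f k) e\<bar>\<^sup>2 < \<epsilon>\<^sup>2"
        using c by simp
      then show ?thesis
        unfolding dist_real_def using \<open>0 < \<epsilon>\<close> by (meson less_imp_le power2_less_imp_less)
    qed
    show "\<exists>M. \<forall>m\<ge>M. \<forall>n\<ge>M. dist (edge_diff G (f m) e) (edge_diff G (f n) e) < \<epsilon>"
      using close by (intro exI[of _ "max N k0"]) (metis dist_commute nle_le)
  qed
  then show ?thesis by (simp add: Cauchy_convergent_iff)
qed

text \<open>The pointwise limit of \<open>f\<close> exists by propagation along edges from
  \<open>A\<close>. A sum over a fixed \<open>E j\<close> is continuous under this limit and is at
  most \<open>upper k\<close> once \<open>j \<le> k\<close>: Fatou's lemma in elementary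
  form.\<close>

lemma minimizer_exists:
  obtains h where "h \<in> extensional (verts G)" "\<And>a. a \<in> A \<Longrightarrow> h a = \<phi> a"
    "\<And>k. dirichlet_sum G (E k) h \<le> J"
proof -
  obtain u where u: "u \<in> A" using A by blast
  have conv: "convergent (\<lambda>k. f k v)" if "v \<in> verts G" for v
  proof (rule connected_map_induct[of G u v "\<lambda>v. convergent (\<lambda>k. f k v)"])
    show "convergent (\<lambda>k. f k u)" using u by (simp add: f_A convergent_const)
  next
    fix e assume "e \<in> edges G"
    note d = edge_diff_convergent[OF this]
    show "convergent (\<lambda>k. f k (pathstart (curve G e))) \<longleftrightarrow>
        convergent (\<lambda>k. f k (pathfinish (curve G e)))"
      using convergent_add[OF d] convergent_diff[OF _ d]
      by (force simp: edge_diff_def)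
  qed (use connected u A that in auto)
  \<comment> \<open>Restriction fixes the values off the vertex set as the definition of the
    minimizer demands.\<close>
  define h where "h = restrict (\<lambda>v. lim (\<lambda>k. f k v)) (verts G)"
  have h: "(\<lambda>k. f k v) \<longlonglongrightarrow> h v" if "v \<in> verts G" for v
    using conv[OF that] that by (simp add: h_def convergent_LIMSEQ_iff)
  show ?thesis
  proof
    show "h \<in> extensional (verts G)" by (simp add: h_def)
    show "h a = \<phi> a" if "a \<in> A" for a
      using h[of a] that A by (auto simp: f_A LIMSEQ_const_iff)
    fix j
    have "(\<lambda>k. dirichlet_sum G (E j) (f k)) \<longlonglongrightarrow> dirichlet_sum G (E j) h"
      unfolding dirichlet_sum_def edge_diff_def
      by (intro tendsto_intros h network_endpoints[OF network]) (use E_sub in auto)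
    moreover have "dirichlet_sum G (E j) (f k) \<le> upper k" if "j \<le> k" for k
      using dirichlet_sum_mono[OF network E_sub E_finite, of "E j" k "f k"] upper[of k]
          E_mono[THEN monoD, OF that] by linarith
    ultimately show "dirichlet_sum G (E j) h \<le> J"
      using upper_lim by (intro LIMSEQ_le[of _ _ upper J]) auto
  qed
qed

lemma J_le_energy:
  assumes "\<And>a. a \<in> A \<Longrightarrow> g a = \<phi> a"
  shows "ennreal J \<le> energy G g"
proof (rule LIMSEQ_le_const2)
  show "(\<lambda>k. ennreal (lower k)) \<longlonglongrightarrow> ennreal J"
    by (rule tendsto_ennrealI[OF lower_lim])
  show "\<exists>N. \<forall>k\<ge>N. ennreal (lower k) \<le> energy G g"
    using ennreal_leI[OF lower[OF assms]]
      dirichlet_sum_le_energy[OF network E_sub E_finite] order_trans by blast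
qed

text \<open>Every finite set of edges lies in a single \<open>E k\<close>, as the sets increase to
  \<open>edges G\<close>.\<close>

lemma energy_le_J:
  assumes "\<And>k. dirichlet_sum G (E k) h \<le> J"
  shows "energy G h \<le> ennreal J"
proof (rule energy_le[OF network])
  fix F assume F: "F \<subseteq> edges G" "finite F"
  have "eventually (\<lambda>k. e \<in> E k) sequentially" if "e \<in> F" for e
  proof -
    obtain k where "e \<in> E k" using \<open>e \<in> F\<close> F(1) E_UN by blast
    then show ?thesis
      using E_mono by (intro eventually_sequentiallyI[of k]) (blast dest: monoD)
  qed
  then have "eventually (\<lambda>k. \<forall>e\<in>F. e \<in> E k) sequentially"
    by (intro eventually_ball_finite F) blast
  then obtain k where "F \<subseteq> E k"
    by (auto simp: eventually_sequentially)
  then show "dirichlet_sum G F h \<le> J"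
    using dirichlet_sum_mono[OF network E_sub E_finite] assms order_trans by blast
qed

lemma le_J_of_energy_le:
  assumes "energy G h \<le> ennreal J"
  shows "dirichlet_sum G (E k) h \<le> J"
proof -
  \<comment> \<open>\<open>ennreal\<close> sends negative reals to 0; the sign of \<open>J\<close>
    lets the inequality return to the reals.\<close>
  have "0 \<le> J"
    by (rule LIMSEQ_le_const[OF upper_lim])
       (use upper dirichlet_sum_nonneg[OF network E_sub] order_trans in blast)
  moreover have "ennreal (dirichlet_sum G (E k) h) \<le> ennreal J"
    using dirichlet_sum_le_energy[OF network E_sub E_finite] assms order_trans by blast
  ultimately show ?thesis by simp
qed

text \<open>The description in \<open>energy_minimizer\<close> denotes: the limit function
  minimizes, and any other minimizer has energy at most \<open>J\<close>, so it is the limit of the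
  same sequence \<open>f\<close>.\<close>

lemma energy_minimizer:
  shows "\<And>a. a \<in> A \<Longrightarrow> energy_minimizer G A \<phi> a = \<phi> a"
    and "\<And>k. dirichlet_sum G (E k) (energy_minimizer G A \<phi>) \<le> J"
proof -
  let ?P = "\<lambda>h. h \<in> extensional (verts G) \<and> (\<forall>a\<in>A. h a = \<phi> a) \<and>
             (\<forall>g. (\<forall>a\<in>A. g a = \<phi> a) \<longrightarrow> energy G h \<le> energy G g)"
  obtain h where h: "h \<in> extensional (verts G)" "\<And>a. a \<in> A \<Longrightarrow> h a = \<phi> a"
    "\<And>k. dirichlet_sum G (E k) h \<le> J" using minimizer_exists by blast
  have Ph: "?P h"
    using h energy_le_J[OF h(3)] J_le_energy order_trans by blast
  have le_J: "dirichlet_sum G (E k) h' \<le> J" if "?P h'" for h' k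
    using that h energy_le_J[OF h(3)] order_trans by (blast intro: le_J_of_energy_le)
  have "h' = h" if "?P h'" for h'
  proof (rule extensionalityI)
    show "h' v = h v" if "v \<in> verts G" for v
      using tendsto_minimizer[of h' v] tendsto_minimizer[of h v] h le_J \<open>?P h'\<close> that LIMSEQ_unique
      by blast
  qed (use that h in auto)
  with Ph have "?P (energy_minimizer G A \<phi>)"
    unfolding energy_minimizer_def by (intro theI[of ?P h]) blast+
  then show "\<And>a. a \<in> A \<Longrightarrow> energy_minimizer G A \<phi> a = \<phi> a"
    and "\<And>k. dirichlet_sum G (E k) (energy_minimizer G A \<phi>) \<le> J"
    using le_J by blast+
qed

lemma tendsto_energy_minimizer:
  "v \<in> verts G \<Longrightarrow> (\<lambda>k. f k v) \<longlonglongrightarrow> energy_minimizer G A \<phi> v"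
  using tendsto_minimizer energy_minimizer by blast

end

section \<open>Minimizers on a finite network\<close>

locale finite_network =
  fixes G :: "'e cmap" and A :: "complex set"
  assumes network: "network G" and connected: "connected_map G" and finite: "finite_map G"
    and A: "A \<subseteq> verts G" "A \<noteq> {}"
begin

lemma edges_finite: "finite (edges G)"
  using finite by (simp add: finite_map_def)

text \<open>A sequence of competitors within \<open>1 / Suc k\<close> of the infimum is almost
  minimizing for the constant exhaustion by \<open>edges G\<close>, with \<open>J\<close> the
  infimum itself.\<close>

lemma minimizer:
  shows "a \<in> A \<Longrightarrow> energy_minimizer G A \<phi> a = \<phi> a"
    and "(\<And>a. a \<in> A \<Longrightarrow> g a = \<phi> a) \<Longrightarrow>
      dirichlet_sum G (edges G) (energy_minimizer G A \<phi>) \<le> dirichlet_sum G (edges G) g"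
proof -
  define S where "S = dirichlet_sum G (edges G) ` {g. \<forall>a\<in>A. g a = \<phi> a}"
  have ne: "S \<noteq> {}" by (auto simp: S_def)
  have bdd: "bdd_below S"
    using dirichlet_sum_nonneg[OF network order.refl] by (auto simp: S_def bdd_below_def)
  have "\<exists>g. (\<forall>a\<in>A. g a = \<phi> a) \<and> dirichlet_sum G (edges G) g < Inf S + 1 / Suc k" for k
    using cInf_lessD[OF ne, of "Inf S + 1 / Suc k"] by (auto simp: S_def)
  then obtain f where f: "\<And>k. (\<forall>a\<in>A. f k a = \<phi> a) \<and>
      dirichlet_sum G (edges G) (f k) < Inf S + 1 / Suc k" by metis
  have Inf_le: "Inf S \<le> dirichlet_sum G (edges G) g" if "\<And>a. a \<in> A \<Longrightarrow> g a = \<phi> a" for g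
    by (rule cInf_lower[OF _ bdd]) (use that in \<open>auto simp: S_def\<close>)
  have "(\<lambda>k. Inf S + 1 / Suc k) \<longlonglongrightarrow> Inf S + 0"
    by (intro tendsto_intros LIMSEQ_Suc[OF lim_1_over_n])
  then interpret almost_minimizing G A \<phi> "\<lambda>_. edges G" f "\<lambda>k. Inf S + 1 / Suc k" "\<lambda>_. Inf S" "Inf S"
    by unfold_locales
       (use network connected A edges_finite f Inf_le in \<open>auto intro: less_imp_le simp: mono_def\<close>)
  show "a \<in> A \<Longrightarrow> energy_minimizer G A \<phi> a = \<phi> a" by (rule energy_minimizer)
  show "(\<And>a. a \<in> A \<Longrightarrow> g a = \<phi> a) \<Longrightarrow>
      dirichlet_sum G (edges G) (energy_minimizer G A \<phi>) \<le> dirichlet_sum G (edges G) g"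
    using energy_minimizer(2) Inf_le order_trans by blast
qed

text \<open>The constant sequence \<open>h\<close> is almost minimizing, so its limit
  \<open>h\<close> agrees with the minimizer on the vertices.\<close>

lemma minimizer_unique:
  assumes h: "\<And>a. a \<in> A \<Longrightarrow> h a = \<phi> a"
    and min: "\<And>g. (\<And>a. a \<in> A \<Longrightarrow> g a = \<phi> a) \<Longrightarrow>
      dirichlet_sum G (edges G) h \<le> dirichlet_sum G (edges G) g"
    and v: "v \<in> verts G"
  shows "energy_minimizer G A \<phi> v = h v"
proof -
  let ?I = "dirichlet_sum G (edges G) h"
  interpret almost_minimizing G A \<phi> "\<lambda>_. edges G" "\<lambda>_. h" "\<lambda>_. ?I" "\<lambda>_. ?I" ?I
    by unfold_locales (use network connected A edges_finite h min in \<open>auto simp: mono_def\<close>)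
  show ?thesis using tendsto_energy_minimizer[OF v] by (simp add: LIMSEQ_const_iff)
qed

lemma minimizer_orthogonal:
  assumes g: "\<And>a. a \<in> A \<Longrightarrow> g a = 0"
  shows "dirichlet_form G (edges G) (energy_minimizer G A \<phi>) g = 0"
proof (rule ccontr)
  let ?h = "energy_minimizer G A \<phi>"
  let ?B = "dirichlet_form G (edges G) ?h g"
  let ?D = "dirichlet_sum G (edges G) g"
  assume B: "?B \<noteq> 0"
  have D: "0 \<le> ?D" by (rule dirichlet_sum_nonneg[OF network order.refl])
  \<comment> \<open>The quadratic in \<open>r\<close> is smallest at \<open>- ?B / ?D\<close>; the
    added 1 covers \<open>?D = 0\<close> and still leaves a negative value.\<close>
  define r where "r = - ?B / (?D + 1)"
  have "dirichlet_sum G (edges G) ?h \<le> dirichlet_sum G (edges G) (\<lambda>v. ?h v + r * g v)"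
    by (rule minimizer) (simp add: minimizer g)
  then have "0 \<le> 2 * r * ?B + r\<^sup>2 * ?D"
    unfolding dirichlet_sum_add_scaled by linarith
  also have "r\<^sup>2 * ?D \<le> r\<^sup>2 * (?D + 1)" by (simp add: algebra_simps)
  also have "2 * r * ?B + r\<^sup>2 * (?D + 1) = - ?B\<^sup>2 / (?D + 1)"
    using D by (simp add: r_def power2_eq_square divide_simps)
  also have "\<dots> < 0" using B D by simp
  finally show False by simp
qed

text \<open>The combination inherits orthogonality to functions vanishing on \<open>A\<close> from
  its summands. By Pythagoras any competitor then has at least its energy, so it is the minimizer
  for \<open>\<phi>\<close>.\<close>

lemma minimizer_eq_sum:
  assumes finA: "finite A" and v: "v \<in> verts G"
  shows "energy_minimizer G A \<phi> v = (\<Sum>a\<in>A. \<phi> a * energy_minimizer G A (indicator {a}) v)"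
proof -
  define h where "h = (\<lambda>v. \<Sum>a\<in>A. \<phi> a * energy_minimizer G A (indicator {a}) v)"
  have h_A: "h b = \<phi> b" if "b \<in> A" for b
  proof -
    have "h b = (\<Sum>a\<in>A. if b = a then \<phi> a else 0)"
      unfolding h_def by (rule sum.cong) (auto simp: minimizer(1)[OF that])
    then show ?thesis using that finA by simp
  qed
  have "energy_minimizer G A \<phi> v = h v"
  proof (rule minimizer_unique[OF _ _ v])
    fix g assume g: "\<And>a. a \<in> A \<Longrightarrow> g a = \<phi> a"
    let ?d = "\<lambda>v. g v - h v"
    have "dirichlet_form G (edges G) (energy_minimizer G A (indicator {a})) ?d = 0" for a
      by (rule minimizer_orthogonal) (simp add: g h_A)
    then have "dirichlet_form G (edges G) h ?d = 0"
      by (subst h_def) (simp add: dirichlet_form_sum_left)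
    then have "dirichlet_sum G (edges G) g
        = dirichlet_sum G (edges G) h + dirichlet_sum G (edges G) ?d"
      using dirichlet_sum_add_scaled[of G "edges G" h 1 ?d] by simp
    then show "dirichlet_sum G (edges G) h \<le> dirichlet_sum G (edges G) g"
      using dirichlet_sum_nonneg[OF network order.refl, of ?d] by linarith
  qed (rule h_A)
  then show ?thesis by (simp add: h_def)
qed

end

section \<open>Exhaustion of an infinite network by finite ones\<close>

locale network_exhaustion =
  fixes G :: "'e cmap" and H :: "nat \<Rightarrow> 'e cmap" and A :: "complex set"
  assumes network: "network G" and connected: "connected_map G"
    and degrees: "finite_vertex_degrees G"
    and A: "A \<noteq> {}" "finite A" "A \<subseteq> verts (H k)"
    and H: "submap (H k) G" "finite_map (H k)" "connected_map (H k)"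
    and H_Suc: "submap (H k) (H (Suc k))"
    and H_verts: "(\<Union>k. verts (H k)) = verts G" and H_edges: "(\<Union>k. edges (H k)) = edges G"
begin

lemma submap_network: "network (H k)"
  using H(1)[of k] network by (auto simp: submap_def network_def)

lemma finite_network_H: "finite_network (H k) A"
  by unfold_locales (use submap_network A H in auto)

lemma edges_H_mono: "mono (\<lambda>k. edges (H k))" and verts_H_mono: "mono (\<lambda>k. verts (H k))"
  using H_Suc by (auto simp: mono_iff_le_Suc submap_def)

lemma dirichlet_sum_H:
  assumes "F \<subseteq> edges (H k)"
  shows "dirichlet_sum (H k) F = dirichlet_sum G F"
  unfolding dirichlet_sum_def edge_diff_def fun_eq_iff
  by (intro allI sum.cong) (use H(1)[of k] assms in \<open>auto simp: submap_def subset_iff\<close>)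

text \<open>The extension of \<open>\<phi>\<close> by 0 varies only across edges that meet
  \<open>A\<close>. There are finitely many of these, since \<open>A\<close> and all vertex degrees
  are finite, so its energy is a bound independent of \<open>k\<close>.\<close>

lemma minimal_energy_bounded:
  "\<exists>B. \<forall>k. dirichlet_sum (H k) (edges (H k)) (energy_minimizer (H k) A \<phi>) \<le> B"
proof -
  define g where "g = (\<lambda>v. if v \<in> A then \<phi> v else 0)"
  define F where "F = (\<Union>v\<in>A. {e \<in> edges G. v \<in> ends G e})"
  have "A \<subseteq> verts G" using A(3) H_verts by blast
  then have F: "finite F" "F \<subseteq> edges G"
    using A degrees by (auto simp: F_def finite_vertex_degrees_def)
  have "dirichlet_sum (H k) (edges (H k)) (energy_minimizer (H k) A \<phi>) \<le> dirichlet_sum G F g" for k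
  proof -
    interpret finite_network "H k" A by (rule finite_network_H)
    have sub: "edges (H k) \<subseteq> edges G" using H(1) by (simp add: submap_def)
    have "dirichlet_sum (H k) (edges (H k)) (energy_minimizer (H k) A \<phi>)
        \<le> dirichlet_sum (H k) (edges (H k)) g"
      by (rule minimizer) (simp add: g_def)
    also have "\<dots> = dirichlet_sum G (edges (H k)) g" by (simp add: dirichlet_sum_H)
    also have "\<dots> = dirichlet_sum G (edges (H k) \<inter> F) g"
      unfolding dirichlet_sum_def
      by (rule sum.mono_neutral_right)
         (use edges_finite sub in \<open>auto simp: F_def g_def edge_diff_def ends_def\<close>)
    also have "\<dots> \<le> dirichlet_sum G F g"
      using F by (intro dirichlet_sum_mono network_exhaustion.network[OF network_exhaustion_axioms]) auto
    finally show ?thesis .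
  qed
  then show ?thesis by blast
qed

text \<open>Both \<open>upper\<close> and \<open>lower\<close> are the minimal energies
  \<open>I\<close>. They increase, because the minimizer on \<open>H (Suc k)\<close> competes on
  \<open>H k\<close>, and they are bounded, hence have a limit \<open>J\<close>.\<close>

theorem energy_minimizer_tendsto:
  assumes "v \<in> verts G"
  shows "(\<lambda>k. energy_minimizer (H k) A \<phi> v) \<longlonglongrightarrow> energy_minimizer G A \<phi> v"
proof -
  let ?f = "\<lambda>k. energy_minimizer (H k) A \<phi>"
  define I where "I = (\<lambda>k. dirichlet_sum (H k) (edges (H k)) (?f k))"
  have I_eq: "I k = dirichlet_sum G (edges (H k)) (?f k)" for k
    by (simp add: I_def dirichlet_sum_H)
  have I_le: "I k \<le> dirichlet_sum G (edges (H k)) g" if "\<And>a. a \<in> A \<Longrightarrow> g a = \<phi> a" for g k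
    using finite_network.minimizer(2)[OF finite_network_H, of g \<phi> k] that
    by (simp add: I_def dirichlet_sum_H)
  have f_A: "?f k a = \<phi> a" if "a \<in> A" for k a
    using finite_network.minimizer(1)[OF finite_network_H that] .
  have sub: "edges (H k) \<subseteq> edges G" for k using H_edges by blast
  have fin: "finite (edges (H k))" for k using H(2) by (simp add: finite_map_def)
  have "I k \<le> I (Suc k)" for k
  proof -
    have "I k \<le> dirichlet_sum G (edges (H k)) (?f (Suc k))" by (rule I_le) (rule f_A)
    also have "\<dots> \<le> I (Suc k)"
      unfolding I_eq using edges_H_mono
      by (intro dirichlet_sum_mono network sub fin) (simp add: mono_iff_le_Suc)
    finally show ?thesis .
  qed
  then have "incseq I" by (rule incseq_SucI)
  moreover obtain B where "\<forall>k. I k \<le> B"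
    using minimal_energy_bounded[of \<phi>] by (auto simp: I_def)
  ultimately obtain J where J: "I \<longlonglongrightarrow> J" by (metis incseq_convergent)
  have "A \<subseteq> verts G" using A(3) H_verts by blast
  then interpret almost_minimizing G A \<phi> "\<lambda>k. edges (H k)" ?f I I J
    by unfold_locales
       (use network connected A(1) H_edges fin edges_H_mono f_A I_le J in \<open>auto simp flip: I_eq\<close>)
  show ?thesis using assms by (rule tendsto_energy_minimizer)
qed

text \<open>By linearity the change from \<open>\<phi>\<close> to \<open>\<phi>' k\<close> adds
  finitely many convergent harmonic measures with coefficients tending to 0.\<close>

lemma energy_minimizer_tendsto_varying:
  assumes v: "v \<in> verts G" and \<phi>: "\<And>a. a \<in> A \<Longrightarrow> (\<lambda>k. \<phi>' k a) \<longlonglongrightarrow> \<phi> a"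
  shows "(\<lambda>k. energy_minimizer (H k) A (\<phi>' k) v) \<longlonglongrightarrow> energy_minimizer G A \<phi> v"
proof -
  let ?e = "\<lambda>k a. energy_minimizer (H k) A (indicator {a}) v"
  obtain k0 where k0: "v \<in> verts (H k0)" using v H_verts by blast
  have "(\<lambda>k. \<Sum>a\<in>A. (\<phi>' k a - \<phi> a) * ?e k a)
      \<longlonglongrightarrow> (\<Sum>a\<in>A. (\<phi> a - \<phi> a) * energy_minimizer G A (indicator {a}) v)"
    by (intro tendsto_intros \<phi> energy_minimizer_tendsto v)
  from tendsto_add[OF energy_minimizer_tendsto[OF v, of \<phi>] this]
  have lim: "(\<lambda>k. energy_minimizer (H k) A \<phi> v + (\<Sum>a\<in>A. (\<phi>' k a - \<phi> a) * ?e k a))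
      \<longlonglongrightarrow> energy_minimizer G A \<phi> v" by simp
  show ?thesis
  \<comment> \<open>Linearity on \<open>H k\<close> is available at its own vertices, hence at
    \<open>v\<close> from \<open>k0\<close> on.\<close>
  proof (rule Lim_transform_eventually[OF lim], rule eventually_sequentiallyI)
    fix k assume "k0 \<le> k"
    with k0 have "v \<in> verts (H k)" using verts_H_mono[THEN monoD] by blast
    note eq = finite_network.minimizer_eq_sum[OF finite_network_H A(2) this]
    show "energy_minimizer (H k) A \<phi> v + (\<Sum>a\<in>A. (\<phi>' k a - \<phi> a) * ?e k a)
        = energy_minimizer (H k) A (\<phi>' k) v"
      unfolding eq[of \<phi>] eq[of "\<phi>' k"] by (simp add: left_diff_distrib sum_subtractf)
  qed
qed

section \<open>Convergence of the Tutte embeddings\<close>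

lemma tutte_embedding_tendsto:
  assumes ys: "ys ` {1..m} = A" and x: "x \<in> verts G" and v: "v \<in> verts G"
  shows "(\<lambda>k. tutte_embedding (H k) x m ys v) \<longlonglongrightarrow> tutte_embedding G x m ys v"
proof -
  \<comment> \<open>The index that \<open>the_inv_into\<close> assigns to \<open>a\<close> depends
    on \<open>ys\<close> alone, so each boundary value is one fixed continuous function of finitely
    many harmonic measures at \<open>x\<close>.\<close>
  have "(\<lambda>k. tutte_boundary (H k) x m ys a) \<longlonglongrightarrow> tutte_boundary G x m ys a" for a
    unfolding tutte_boundary_def Let_def hm_def ys
    by (intro tendsto_intros energy_minimizer_tendsto x)
  then show ?thesis
    unfolding tutte_embedding_def ys
    by (intro tendsto_Complex energy_minimizer_tendsto_varying v tendsto_Re tendsto_Im)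
qed

end

theorem lemma5p4:
  fixes G :: "'e cmap" and Gn :: "nat \<Rightarrow> 'e cmap"
    and x y :: complex and m :: nat and ys :: "nat \<Rightarrow> complex"
  assumes "planar_map G" and "connected_map G"
    and "finite_vertex_degrees G" and "finite_face_degrees G"
    and "has_external_face G"
    and "x \<in> verts G - boundary_verts G" and "y \<in> boundary_verts G"
    and "boundary_enumeration G y m ys"
    and "\<And>n. n \<ge> 1 \<Longrightarrow> submap (Gn n) G \<and> finite_map (Gn n) \<and> connected_map (Gn n)"
    and "\<And>n. n \<ge> 1 \<Longrightarrow> submap (Gn n) (Gn (Suc n))"
    and "(\<Union>n\<in>{1..}. verts (Gn n)) = verts G" and "(\<Union>n\<in>{1..}. edges (Gn n)) = edges G"
    and "\<And>n. n \<ge> 1 \<Longrightarrow> boundary_verts G \<union> {x} \<subseteq> verts (Gn n)"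
  shows "\<forall>v\<in>verts G. (\<lambda>n. tutte_embedding (Gn n) x m ys v) \<longlonglongrightarrow> tutte_embedding G x m ys v"
proof
  fix v assume v: "v \<in> verts G"
  have ys: "ys ` {1..m} = boundary_verts G"
    using assms(8) by (auto simp: boundary_enumeration_def bij_betw_def)
  have range: "{1..} = range Suc" by (auto simp: image_iff Suc_le_eq gr0_conv_Suc)
  \<comment> \<open>The given family starts at 1 and the exhaustion at 0; the shift by
    \<open>Suc\<close> is undone in the last step.\<close>
  interpret network_exhaustion G "\<lambda>k. Gn (Suc k)" "boundary_verts G"
  proof
    show "network G" using assms(1) by (auto simp: planar_map_def network_def)
    show "finite (boundary_verts G)" unfolding ys[symmetric] by simp
    show "(\<Union>k. verts (Gn (Suc k))) = verts G" "(\<Union>k. edges (Gn (Suc k))) = edges G"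
      using assms(11,12) unfolding range by simp_all
  qed (use assms in auto)
  have "(\<lambda>k. tutte_embedding (Gn (Suc k)) x m ys v) \<longlonglongrightarrow> tutte_embedding G x m ys v"
    using tutte_embedding_tendsto[OF ys _ v] assms(6) by blast
  then show "(\<lambda>n. tutte_embedding (Gn n) x m ys v) \<longlonglongrightarrow> tutte_embedding G x m ys v"
    by (rule LIMSEQ_imp_Suc)
qed

end
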